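(* Let $\beta>1$ be real. Then $\mathrm{Fin}(-\beta)=\{0\}$ if and only if $\beta<\frac12(1+\sqrt5)$.
   Context: Let $\beta>1$, $I_\beta=\big[\frac{-\beta}{\beta+1},\frac1{\beta+1}\big)$ and $T_{-\beta}:I_\beta\to I_\beta$, $T_{-\beta}(x)=-\beta x-\lfloor -\beta x+\frac{\beta}{\beta+1}\rfloor$. For $y\in I_\beta$ put $y_i=\lfloor -\beta T_{-\beta}^{i-1}(y)+\frac{\beta}{\beta+1}\rfloor$ ($i\ge1$) and $d_{-\beta}(y)=y_1y_2y_3\cdots$; then $y=\sum_{i\ge1}y_i(-\beta)^{-i}$. The $(-\beta)$-expansion of a real $x$ is defined as follows: take the minimal non-negative integer $j$ with $y=x(-\beta)^{-j}\in\big(\frac{-\beta}{\beta+1},\frac1{\beta+1}\big)$ (open interval), compute $d_{-\beta}(y)=y_1y_2\cdots$; the expansion is $x=\sum_{i\ge1}y_i(-\beta)^{j-i}$, i.e. the digit $y_i$ is the coefficient of $(-\beta)^{j-i}$ (written $y_1\cdots y_j\bullet y_{j+1}y_{j+2}\cdots$, or $0\bullet y_1y_2\cdots$ if $j=0$). $\mathrm{Fin}(-\beta)$ denotes the set of real numbers whose $(-\beta)$-expansion has only finitely many non-zero digits. *)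

theory Defs
  imports Complex_Main
begin

definition neg_beta_interval :: "real \<Rightarrow> real set" where
  "neg_beta_interval \<beta> = {- \<beta> / (\<beta> + 1) ..< 1 / (\<beta> + 1)}"

text \<open>The map is only meaningful on \<open>neg_beta_interval \<beta>\<close>; in the expansion of a real
  number it is only ever iterated from a point of that interval, which it maps to itself.\<close>

definition neg_beta_map :: "real \<Rightarrow> real \<Rightarrow> real" where
  "neg_beta_map \<beta> x = - \<beta> * x - of_int \<lfloor>- \<beta> * x + \<beta> / (\<beta> + 1)\<rfloor>"

lemma neg_beta_map_in_interval:
  assumes "\<beta> > 1"
  shows "neg_beta_map \<beta> x \<in> neg_beta_interval \<beta>"
proof -
  have "1 / (\<beta> + 1) = 1 - \<beta> / (\<beta> + 1)"
    using assms by (simp add: field_simps)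
  moreover have "of_int \<lfloor>- \<beta> * x + \<beta> / (\<beta> + 1)\<rfloor> \<le> - \<beta> * x + \<beta> / (\<beta> + 1)"
    "- \<beta> * x + \<beta> / (\<beta> + 1) < of_int \<lfloor>- \<beta> * x + \<beta> / (\<beta> + 1)\<rfloor> + 1"
    by linarith+
  ultimately show ?thesis
    unfolding neg_beta_map_def neg_beta_interval_def atLeastLessThan_iff minus_divide_left [symmetric]
    by linarith
qed

text \<open>Digits are indexed from 1; the value at index 0 is junk and never used.\<close>

definition neg_beta_digit :: "real \<Rightarrow> real \<Rightarrow> nat \<Rightarrow> int" where
  "neg_beta_digit \<beta> y i = \<lfloor>- \<beta> * (neg_beta_map \<beta> ^^ (i - 1)) y + \<beta> / (\<beta> + 1)\<rfloor>"

definition neg_beta_shift :: "real \<Rightarrow> real \<Rightarrow> nat" where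
  "neg_beta_shift \<beta> x = (LEAST j. x / (- \<beta>) ^ j \<in> {- \<beta> / (\<beta> + 1) <..< 1 / (\<beta> + 1)})"

text \<open>For \<open>\<beta> > 1\<close> the minimum is over a nonempty set.\<close>

lemma neg_beta_shift_exists:
  fixes \<beta> x :: real
  assumes "\<beta> > 1"
  shows "\<exists>j. x / (- \<beta>) ^ j \<in> {- \<beta> / (\<beta> + 1) <..< 1 / (\<beta> + 1)}"
proof -
  obtain j where j: "\<bar>x\<bar> * (\<beta> + 1) < \<beta> ^ j"
    using real_arch_pow[OF assms] by blast
  have "\<bar>x / (- \<beta>) ^ j\<bar> = \<bar>x\<bar> / \<beta> ^ j"
    using assms by (simp add: power_abs)
  also have "\<dots> < 1 / (\<beta> + 1)"
    using j assms by (simp add: field_simps)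
  finally have *: "\<bar>x / (- \<beta>) ^ j\<bar> < 1 / (\<beta> + 1)" .
  have "1 / (\<beta> + 1) \<le> \<beta> / (\<beta> + 1)"
    using assms by (intro divide_right_mono) auto
  then have "x / (- \<beta>) ^ j \<in> {- \<beta> / (\<beta> + 1) <..< 1 / (\<beta> + 1)}"
    using * unfolding greaterThanLessThan_iff minus_divide_left [symmetric] by linarith
  then show ?thesis ..
qed

text \<open>The \<open>(-\<beta>)\<close>-expansion of \<open>x\<close> as a two-sided sequence: the value at \<open>k\<close> is the coefficient
  of \<open>(-\<beta>) powi k\<close>. With \<open>j\<close> the shift of \<open>x\<close> and \<open>y = x (-\<beta>)\<^sup>-\<^sup>j\<close>, the digit \<open>y\<^sub>i\<close>
  (\<open>i \<ge> 1\<close>) sits at position \<open>k = j - i\<close>; positions \<open>k \<ge> j\<close> carry no digit.\<close>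

definition neg_beta_expansion :: "real \<Rightarrow> real \<Rightarrow> int \<Rightarrow> int" where
  "neg_beta_expansion \<beta> x k =
     (let j = neg_beta_shift \<beta> x in
      if k < int j then neg_beta_digit \<beta> (x / (- \<beta>) ^ j) (nat (int j - k)) else 0)"

definition Fin_neg_beta :: "real \<Rightarrow> real set" where
  "Fin_neg_beta \<beta> = {x. finite {k. neg_beta_expansion \<beta> x k \<noteq> 0}}"

end

theory Submission
  imports Defs
begin

text \<open>A point has a finite expansion iff its orbit under \<open>T = neg_beta_map \<beta>\<close> reaches \<open>0\<close>. A
  nonzero orbit reaching \<open>0\<close> passes through some \<open>z \<noteq> 0\<close> with \<open>T z = 0\<close>, that is, \<open>z = - d / \<beta>\<close>
  with a nonzero integer \<open>d\<close>. Such a \<open>z\<close> lies in \<open>I\<^sub>\<beta>\<close> only if \<open>d \<ge> 1\<close> and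
  \<open>1 / \<beta> \<le> \<beta> / (\<beta> + 1)\<close>, i.e. \<open>\<beta> + 1 \<le> \<beta>\<^sup>2\<close>. Conversely, if \<open>\<beta> + 1 < \<beta>\<^sup>2\<close> then \<open>- 1 / \<beta>\<close> is
  itself finite; if \<open>\<beta>\<close> is the golden ratio, \<open>- 1 / \<beta>\<close> is the excluded left end point, but it has
  the interior preimage \<open>1 / \<beta>\<^sup>2 - 1 / \<beta>\<close>.\<close>

lemma golden_ratio_le_iff:
  fixes \<beta> :: real
  assumes "\<beta> > 0"
  shows "(1 / 2) * (1 + sqrt 5) \<le> \<beta> \<longleftrightarrow> \<beta> + 1 \<le> \<beta>\<^sup>2"
proof -
  have "(1 / 2) * (1 + sqrt 5) \<le> \<beta> \<longleftrightarrow> sqrt 5 \<le> 2 * \<beta> - 1"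
    by auto
  also have "\<dots> \<longleftrightarrow> 5 \<le> (2 * \<beta> - 1)\<^sup>2 \<and> 0 \<le> 2 * \<beta> - 1"
    by (smt (verit) real_le_lsqrt real_less_rsqrt real_sqrt_ge_zero real_sqrt_le_iff
        real_sqrt_abs)
  also have "\<dots> \<longleftrightarrow> \<beta> + 1 \<le> \<beta>\<^sup>2"
  proof -
    \<comment> \<open>The quadratic inequality already forces the sign condition left over from
      squaring: a positive \<beta> below 1/2 satisfies
      \<open>\<beta> * \<beta> \<le> \<beta>\<close>.\<close>
    have "0 \<le> 2 * \<beta> - 1" if "\<beta> + 1 \<le> \<beta>\<^sup>2"
    proof (rule ccontr)
      assume "\<not> 0 \<le> 2 * \<beta> - 1"
      then have "\<beta> * \<beta> \<le> 1 * \<beta>"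
        using assms by (intro mult_right_mono) auto
      with that show False by (simp add: power2_eq_square)
    qed
    then show ?thesis
      by (auto simp: power2_eq_square algebra_simps)
  qed
  finally show ?thesis .
qed

lemma neg_beta_map_0:
  assumes "\<beta> > 1"
  shows "neg_beta_map \<beta> 0 = 0"
proof -
  have "\<lfloor>\<beta> / (\<beta> + 1)\<rfloor> = 0"
    using assms by (simp add: floor_eq_iff)
  then show ?thesis
    by (simp add: neg_beta_map_def)
qed

text \<open>The interval is half-open of length 1, so at most one integer shift lands in it. This
  evaluates the map at explicit points once the digit is guessed.\<close>

lemma neg_beta_map_eqI:
  assumes "- \<beta> * x - of_int d \<in> neg_beta_interval \<beta>" and "\<beta> > 1"
  shows "neg_beta_map \<beta> x = - \<beta> * x - of_int d"
proof -
  have "1 / (\<beta> + 1) = 1 - \<beta> / (\<beta> + 1)"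
    using assms by (simp add: field_simps)
  then have "\<lfloor>- \<beta> * x + \<beta> / (\<beta> + 1)\<rfloor> = d"
    using assms(1)
    unfolding neg_beta_interval_def floor_eq_iff atLeastLessThan_iff minus_divide_left [symmetric]
    by linarith
  then show ?thesis
    by (simp add: neg_beta_map_def)
qed

lemma neg_beta_digit_Suc:
  "neg_beta_digit \<beta> y (Suc n) =
     \<lfloor>- \<beta> * (neg_beta_map \<beta> ^^ n) y + \<beta> / (\<beta> + 1)\<rfloor>"
  by (simp add: neg_beta_digit_def)

lemma funpow_neg_beta_map_Suc:
  "(neg_beta_map \<beta> ^^ Suc n) y =
     - \<beta> * (neg_beta_map \<beta> ^^ n) y - of_int (neg_beta_digit \<beta> y (Suc n))"
  by (simp add: neg_beta_digit_Suc neg_beta_map_def)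

lemma abs_le_1_of_neg_beta_interval:
  assumes "x \<in> neg_beta_interval \<beta>" and "\<beta> > 1"
  shows "\<bar>x\<bar> \<le> 1"
proof -
  have "- 1 \<le> - \<beta> / (\<beta> + 1)" "1 / (\<beta> + 1) \<le> 1"
    using assms(2) by (simp_all add: field_simps)
  then show ?thesis
    using assms(1) unfolding neg_beta_interval_def by auto
qed

text \<open>While the digits vanish, the map is multiplication by \<open>- \<beta>\<close>; since
  the orbit is bounded and \<beta> > 1, it must then sit at 0. Conversely, 0 is a fixed point with
  digit 0.\<close>

lemma eventually_zero_digits_iff:
  assumes "\<beta> > 1"
  shows "(\<exists>n. \<forall>i\<ge>n. neg_beta_digit \<beta> y (Suc i) = 0) \<longleftrightarrow> (\<exists>n. (neg_beta_map \<beta> ^^ n) y = 0)"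
proof
  assume "\<exists>n. \<forall>i\<ge>n. neg_beta_digit \<beta> y (Suc i) = 0"
  then obtain n where n: "\<And>i. i \<ge> n \<Longrightarrow> neg_beta_digit \<beta> y (Suc i) = 0"
    by blast
  \<comment> \<open>At index \<open>Suc n\<close> the point is a value of the map, hence in the
    interval for arbitrary \<open>y\<close>.\<close>
  define z where "z = (neg_beta_map \<beta> ^^ Suc n) y"
  have pow: "(neg_beta_map \<beta> ^^ (k + Suc n)) y = (- \<beta>) ^ k * z" for k
  proof (induction k)
    case (Suc k)
    then show ?case
      using funpow_neg_beta_map_Suc[of "k + Suc n" \<beta> y] n[of "k + Suc n"] by simp
  qed (simp add: z_def)
  have bound: "\<beta> ^ k * \<bar>z\<bar> \<le> 1" for k
  proof -
    have "(neg_beta_map \<beta> ^^ (k + Suc n)) y \<in> neg_beta_interval \<beta>"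
      using neg_beta_map_in_interval[OF assms] by simp
    then have "\<bar>(- \<beta>) ^ k * z\<bar> \<le> 1"
      unfolding pow by (rule abs_le_1_of_neg_beta_interval[OF _ assms])
    then show ?thesis
      using assms by (simp add: abs_mult power_abs)
  qed
  have "z = 0"
  proof (rule ccontr)
    assume "z \<noteq> 0"
    obtain k where "1 / \<bar>z\<bar> < \<beta> ^ k"
      using real_arch_pow[OF assms] by blast
    with \<open>z \<noteq> 0\<close> bound[of k] show False
      by (simp add: field_simps)
  qed
  then show "\<exists>n. (neg_beta_map \<beta> ^^ n) y = 0"
    unfolding z_def by blast
next
  assume "\<exists>n. (neg_beta_map \<beta> ^^ n) y = 0"
  then obtain n where n: "(neg_beta_map \<beta> ^^ n) y = 0"
    by blast
  have "neg_beta_digit \<beta> y (Suc i) = 0" if "i \<ge> n" for i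
  proof -
    have "(neg_beta_map \<beta> ^^ i) y = 0"
      using that
    proof (induction i rule: dec_induct)
      case (step i)
      then show ?case by (simp add: neg_beta_map_0[OF assms])
    qed (rule n)
    then show ?thesis
      using assms by (simp add: neg_beta_digit_Suc floor_eq_iff)
  qed
  then show "\<exists>n. \<forall>i\<ge>n. neg_beta_digit \<beta> y (Suc i) = 0"
    by blast
qed

lemma mem_Fin_neg_beta_iff:
  assumes "\<beta> > 1"
  shows "x \<in> Fin_neg_beta \<beta> \<longleftrightarrow>
    (\<exists>n. (neg_beta_map \<beta> ^^ n) (x / (- \<beta>) ^ neg_beta_shift \<beta> x) = 0)"
proof -
  define j where "j = neg_beta_shift \<beta> x"
  define y where "y = x / (- \<beta>) ^ j"
  define D where "D = {i. neg_beta_digit \<beta> y (Suc i) \<noteq> 0}"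
  \<comment> \<open>Finiteness of the two-sided support is transported to the digit sequence along
    an injective reindexing; \<open>D\<close> counts from 0 but digits from 1, whence the
    \<open>Suc\<close>.\<close>
  have "{k. neg_beta_expansion \<beta> x k \<noteq> 0} = (\<lambda>i. int j - int (Suc i)) ` D"
  proof (intro equalityI subsetI)
    fix k assume "k \<in> {k. neg_beta_expansion \<beta> x k \<noteq> 0}"
    then have k: "k < int j" and "neg_beta_digit \<beta> y (nat (int j - k)) \<noteq> 0"
      by (auto simp: neg_beta_expansion_def Let_def j_def y_def split: if_splits)
    moreover define i where "i = nat (int j - k - 1)"
    ultimately have "i \<in> D" "k = int j - int (Suc i)"
      by (auto simp: D_def Suc_nat_eq_nat_zadd1)
    then show "k \<in> (\<lambda>i. int j - int (Suc i)) ` D"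
      by blast
  next
    fix k assume "k \<in> (\<lambda>i. int j - int (Suc i)) ` D"
    then obtain i where i: "i \<in> D" "k = int j - int (Suc i)"
      by blast
    then have "k < int j" "nat (int j - k) = Suc i"
      by auto
    with i show "k \<in> {k. neg_beta_expansion \<beta> x k \<noteq> 0}"
      by (simp add: neg_beta_expansion_def Let_def D_def flip: j_def y_def)
  qed
  moreover have "inj_on (\<lambda>i. int j - int (Suc i)) D"
    by (auto intro: inj_onI)
  ultimately have "x \<in> Fin_neg_beta \<beta> \<longleftrightarrow> finite D"
    by (simp add: Fin_neg_beta_def finite_image_iff)
  also have "\<dots> \<longleftrightarrow> (\<exists>n. \<forall>i\<ge>n. neg_beta_digit \<beta> y (Suc i) = 0)"
    unfolding finite_nat_set_iff_bounded D_def by (auto simp: not_less) (meson not_less)+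
  also note eventually_zero_digits_iff[OF assms]
  finally show ?thesis
    by (simp add: y_def j_def)
qed

lemma neg_beta_shift_eq_0:
  assumes "x \<in> {- \<beta> / (\<beta> + 1) <..< 1 / (\<beta> + 1)}"
  shows "neg_beta_shift \<beta> x = 0"
  unfolding neg_beta_shift_def using assms by (intro Least_eq_0) simp

lemma mem_Fin_neg_beta_of_orbit:
  assumes "\<beta> > 1" and "x \<in> {- \<beta> / (\<beta> + 1) <..< 1 / (\<beta> + 1)}"
    and "(neg_beta_map \<beta> ^^ n) x = 0"
  shows "x \<in> Fin_neg_beta \<beta>"
  using assms by (auto simp: mem_Fin_neg_beta_iff neg_beta_shift_eq_0)

lemma neg_beta_map_eq_0_imp:
  assumes "\<beta> > 1" "z \<in> neg_beta_interval \<beta>" "z \<noteq> 0" "neg_beta_map \<beta> z = 0"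
  shows "\<beta> + 1 \<le> \<beta>\<^sup>2"
proof -
  define d where "d = \<lfloor>- \<beta> * z + \<beta> / (\<beta> + 1)\<rfloor>"
  have d: "- \<beta> * z = of_int d"
    using assms(4) unfolding neg_beta_map_def d_def by linarith
  then have "d \<noteq> 0"
    using assms by auto
  \<comment> \<open>To the right of 0 the interval is too short: \<beta> times its right end is
    still below 1.\<close>
  moreover have "\<not> d \<le> - 1"
  proof
    assume "d \<le> - 1"
    then have "1 \<le> \<beta> * z"
      using d by linarith
    moreover have "\<beta> * z < \<beta> * (1 / (\<beta> + 1))"
      using assms by (intro mult_strict_left_mono) (auto simp: neg_beta_interval_def)
    moreover have "\<beta> * (1 / (\<beta> + 1)) < 1"
      using assms by (simp add: field_simps)
    ultimately show False by linarith
  qed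
  ultimately have "1 \<le> \<beta> * - z"
    using d by linarith
  also have "\<beta> * - z \<le> \<beta> * (\<beta> / (\<beta> + 1))"
    using assms by (intro mult_left_mono) (auto simp: neg_beta_interval_def)
  finally show ?thesis
    using assms by (simp add: field_simps power2_eq_square)
qed

text \<open>By \<open>neg_beta_map_eq_0_imp\<close>, no nonzero point of the interval is sent to 0
  for such \<beta>. Interval membership is carried through the induction because that lemma requires
  it.\<close>

lemma neg_beta_orbit_nonzero:
  assumes "\<beta> > 1" "\<beta>\<^sup>2 < \<beta> + 1" "y \<in> neg_beta_interval \<beta>" "y \<noteq> 0"
  shows "(neg_beta_map \<beta> ^^ n) y \<in> neg_beta_interval \<beta> - {0}"
proof (induction n)
  case (Suc n)
  then have "neg_beta_map \<beta> ((neg_beta_map \<beta> ^^ n) y) \<noteq> 0"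
    using neg_beta_map_eq_0_imp[OF assms(1)] assms(2) by fastforce
  then show ?case
    using neg_beta_map_in_interval[OF assms(1)] by simp
qed (use assms in simp)

lemma zero_mem_Fin_neg_beta:
  assumes "\<beta> > 1"
  shows "0 \<in> Fin_neg_beta \<beta>"
  using assms by (intro mem_Fin_neg_beta_of_orbit[where n = 0]) (auto simp: field_simps)

lemma Fin_neg_beta_trivial:
  assumes "\<beta> > 1" "\<beta>\<^sup>2 < \<beta> + 1"
  shows "Fin_neg_beta \<beta> = {0}"
proof -
  have False if x: "x \<in> Fin_neg_beta \<beta>" "x \<noteq> 0" for x
  proof -
    define y where "y = x / (- \<beta>) ^ neg_beta_shift \<beta> x"
    have "y \<in> {- \<beta> / (\<beta> + 1) <..< 1 / (\<beta> + 1)}"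
      unfolding y_def neg_beta_shift_def by (rule LeastI_ex[OF neg_beta_shift_exists[OF assms(1)]])
    then have "y \<in> neg_beta_interval \<beta>"
      by (auto simp: neg_beta_interval_def)
    moreover have "y \<noteq> 0"
      using x assms by (simp add: y_def)
    moreover obtain n where "(neg_beta_map \<beta> ^^ n) y = 0"
      using x(1) unfolding mem_Fin_neg_beta_iff[OF assms(1)] y_def by blast
    ultimately show False
      using neg_beta_orbit_nonzero[OF assms] by blast
  qed
  then show ?thesis
    using zero_mem_Fin_neg_beta[OF assms(1)] by blast
qed

lemma neg_beta_map_minus_inverse:
  assumes "\<beta> > 1"
  shows "neg_beta_map \<beta> (- 1 / \<beta>) = 0"
  \<comment> \<open>Digit 1 leaves remainder 0. Only the image has to lie in the interval, so this
    covers every \<beta> > 1.\<close>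
  using assms neg_beta_map_eqI[of \<beta> "- 1 / \<beta>" 1]
  by (simp add: neg_beta_interval_def field_simps)

lemma Fin_neg_beta_nontrivial:
  assumes "\<beta> > 1" "\<beta> + 1 \<le> \<beta>\<^sup>2"
  shows "Fin_neg_beta \<beta> \<noteq> {0}"
proof (cases "\<beta> + 1 = \<beta>\<^sup>2")
  case False
  \<comment> \<open>The left inequality amounts to
    \<open>\<beta> + 1 < \<beta>\<^sup>2\<close>.\<close>
  then have "- 1 / \<beta> \<in> {- \<beta> / (\<beta> + 1) <..< 1 / (\<beta> + 1)}"
    using assms by (simp add: field_simps power2_eq_square add_pos_pos)
  then have "- 1 / \<beta> \<in> Fin_neg_beta \<beta>"
    using neg_beta_map_minus_inverse[OF assms(1)]
    by (intro mem_Fin_neg_beta_of_orbit[where n = 1] assms) simp_all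
  moreover have "- 1 / \<beta> \<noteq> 0"
    using assms by simp
  ultimately show ?thesis by blast
next
  case True
  \<comment> \<open>The solution of \<open>- \<beta> * x - 1 = - 1 / \<beta>\<close>: the preimage
    of the left end point under digit 1.\<close>
  define x where "x = 1 / \<beta>\<^sup>2 - 1 / \<beta>"
  have left: "- \<beta> / (\<beta> + 1) = - 1 / \<beta>" and right: "1 / (\<beta> + 1) = 1 / \<beta>\<^sup>2"
    using assms True by (simp_all add: power2_eq_square)
  have "1 / \<beta>\<^sup>2 < 1 / \<beta>"
    using assms by (simp add: field_simps power2_eq_square)
  then have "x < 0"
    by (simp add: x_def)
  have "x \<in> {- \<beta> / (\<beta> + 1) <..< 1 / (\<beta> + 1)}"
    unfolding left right x_def using assms by auto
  moreover have "(neg_beta_map \<beta> ^^ 2) x = 0"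
  proof -
    have "- \<beta> * x - 1 = - 1 / \<beta>"
      using assms by (simp add: x_def field_simps power2_eq_square)
    \<comment> \<open>The end point is excluded from the open interval that defines the shift, but
      the orbit may visit it: \<open>neg_beta_interval \<beta>\<close> is closed on the
      left.\<close>
    moreover have "- 1 / \<beta> \<in> neg_beta_interval \<beta>"
      unfolding neg_beta_interval_def left right using assms
      by (auto intro: less_trans[of _ 0])
    ultimately have "neg_beta_map \<beta> x = - 1 / \<beta>"
      using neg_beta_map_eqI[of \<beta> x 1] assms(1) by simp
    then show ?thesis
      using neg_beta_map_minus_inverse[OF assms(1)] by (simp add: numeral_2_eq_2)
  qed
  ultimately have "x \<in> Fin_neg_beta \<beta>"
    by (intro mem_Fin_neg_beta_of_orbit assms)
  with \<open>x < 0\<close> show ?thesis by auto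
qed

theorem theorem2:
  fixes \<beta> :: real
  assumes "\<beta> > 1"
  shows "Fin_neg_beta \<beta> = {0} \<longleftrightarrow> \<beta> < (1 / 2) * (1 + sqrt 5)"
  using Fin_neg_beta_trivial[OF assms] Fin_neg_beta_nontrivial[OF assms]
    golden_ratio_le_iff[of \<beta>] assms by linarith

end
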